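(* Fix a tree partition of $\omega$ and a proper ideal $\mathcal J\supseteq\mathrm{Fin}$ on $\omega$. For every $\alpha<\omega_1$, $\mathcal H^{\mathcal J}_\alpha$ is a proper ideal on $\omega$, it is tall if $\alpha\ge1$, and $\mathcal H^{\mathcal J}_\alpha\subsetneq\mathcal H^{\mathcal J}_{\alpha+1}$.
   Context: A tree partition of $\omega$ is a family $\langle A_s:s\in\omega^{<\omega}\rangle$ of infinite subsets of $\omega$ such that $A_\varnothing=\omega$, for each $s$ the family $\{A_{s^\frown n}:n\in\omega\}$ is a partition of $A_s$, and any two distinct points of $\omega$ lie in different cells $A_s\neq A_t$ with $|s|=|t|=n$ for some $n$. For $X\subseteq\omega$ let $T^\infty_X=\{s\in\omega^{<\omega}:X\cap A_s\text{ is infinite}\}$. $\mathrm{Fin}$ is the ideal of finite subsets of $\omega$. For $T\subseteq\omega^{<\omega}$ put $\mathrm{Succ}_T(s)=\{n:s^\frown n\in T\}$ and $D_{\mathcal J}(T)=\{s\in T:\mathrm{Succ}_T(s)\notin\mathcal J\}$; $D^0_{\mathcal J}(T)=T$, $D^{\alpha+1}_{\mathcal J}(T)=D_{\mathcal J}(D^\alpha_{\mathcal J}(T))$, $D^\lambda_{\mathcal J}(T)=\bigcap_{\beta<\lambda}D^\beta_{\mathcal J}(T)$ for limit $\lambda$. For $\alpha<\omega_1$, $\mathcal H^{\mathcal J}_\alpha=\{X\subseteq\omega:\varnothing\notin D^\alpha_{\mathcal J}(T^\infty_X)\}$. An ideal on $\omega$ is proper if it does not contain $\omega$, and tall if every infinite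 subset of $\omega$ contains an infinite member of the ideal. *)

theory Defs
  imports "HOL-Library.Countable_Set_Type" "HOL-Library.Disjoint_Sets"
begin

lemma infinite_Field_omega1: "infinite (Field (cardSuc natLeq))"
  using cardSuc_finite[OF natLeq_Card_order] Field_natLeq by simp

(* The ordinals below \<open>\<omega>\<^sub>1\<close>: the least well-order of cardinality greater than \<open>\<aleph>\<^sub>0\<close>,
   turned into a type so that \<open>\<alpha> < \<omega>\<^sub>1\<close> becomes \<open>\<alpha> :: omega1\<close>. Lemmas countable_below_omega1 and
   uncountable_omega1 characterise this well-order up to isomorphism. *)
typedef omega1 = "Field (cardSuc natLeq)"
  using infinite_Field_omega1 by (metis ex_in_conv finite.emptyI)

lemma Card_order_omega1: "Card_order (cardSuc natLeq)"
  by (rule cardSuc_Card_order[OF natLeq_Card_order])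

lemma wo_rel_omega1: "wo_rel (cardSuc natLeq)"
  using Card_order_omega1 by (auto simp: wo_rel_def card_order_on_def)

instantiation omega1 :: wellorder
begin

definition less_eq_omega1 :: "omega1 \<Rightarrow> omega1 \<Rightarrow> bool" where
  "\<alpha> \<le> \<beta> \<longleftrightarrow> (Rep_omega1 \<alpha>, Rep_omega1 \<beta>) \<in> cardSuc natLeq"

definition less_omega1 :: "omega1 \<Rightarrow> omega1 \<Rightarrow> bool" where
  "\<alpha> < \<beta> \<longleftrightarrow> \<alpha> \<le> \<beta> \<and> \<alpha> \<noteq> (\<beta> :: omega1)"

instance
proof
  fix x y z :: omega1
  show anti: "x \<le> y \<Longrightarrow> y \<le> x \<Longrightarrow> x = y"
    using wo_rel.ANTISYM[OF wo_rel_omega1] Rep_omega1_inject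
    unfolding less_eq_omega1_def antisym_def by metis
  show "(x < y) = (x \<le> y \<and> \<not> y \<le> x)"
    using wo_rel.ANTISYM[OF wo_rel_omega1] wo_rel.REFL[OF wo_rel_omega1] Rep_omega1_inject Rep_omega1
    unfolding less_omega1_def less_eq_omega1_def antisym_def refl_on_def by metis
  show "x \<le> x"
    using wo_rel.REFL[OF wo_rel_omega1] Rep_omega1
    by (auto simp: less_eq_omega1_def refl_on_def)
  show "x \<le> y \<Longrightarrow> y \<le> z \<Longrightarrow> x \<le> z"
    using wo_rel.TRANS[OF wo_rel_omega1] by (auto simp: less_eq_omega1_def trans_def)
  show "x \<le> y \<or> y \<le> x"
    using wo_rel.TOTALS[OF wo_rel_omega1] Rep_omega1 by (auto simp: less_eq_omega1_def)
next
  fix P :: "omega1 \<Rightarrow> bool" and a :: omega1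
  assume step: "\<And>x. (\<And>y. y < x \<Longrightarrow> P y) \<Longrightarrow> P x"
  have wf: "wf (inv_image (cardSuc natLeq - Id) Rep_omega1)"
    using wo_rel.WF[OF wo_rel_omega1] by (rule wf_inv_image)
  show "P a"
    using wf
  proof (induction a rule: wf_induct_rule)
    case (less x)
    show ?case
      by (rule step, rule less) (auto simp: less_omega1_def less_eq_omega1_def Rep_omega1_inject)
  qed
qed

end

lemma less_omega1_iff_underS:
  "\<beta> < \<alpha> \<longleftrightarrow> Rep_omega1 \<beta> \<in> underS (cardSuc natLeq) (Rep_omega1 \<alpha>)"
  by (auto simp: less_omega1_def less_eq_omega1_def underS_def Rep_omega1_inject)

context includes cardinal_syntax begin

lemma countable_below_omega1: "countable {..< \<alpha> :: omega1}"
proof -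
  have "|underS (cardSuc natLeq) (Rep_omega1 \<alpha>)| <o cardSuc natLeq"
    by (rule card_of_underS[OF Card_order_omega1 Rep_omega1])
  then have "countable (underS (cardSuc natLeq) (Rep_omega1 \<alpha>))"
    using cardSuc_ordLeq_ordLess[OF natLeq_Card_order card_of_Card_order] countable_card_le_natLeq
    by blast
  moreover have "Rep_omega1 ` {..<\<alpha>} \<subseteq> underS (cardSuc natLeq) (Rep_omega1 \<alpha>)"
    using less_omega1_iff_underS by auto
  ultimately have "countable (Rep_omega1 ` {..<\<alpha>})"
    by (rule countable_subset[rotated])
  then show ?thesis
    by (rule countable_image_inj_on) (simp add: inj_on_def Rep_omega1_inject)
qed

lemma uncountable_omega1: "uncountable (UNIV :: omega1 set)"
proof
  assume "countable (UNIV :: omega1 set)"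
  then have "countable (Field (cardSuc natLeq))"
    using type_definition.Rep_range[OF type_definition_omega1] by (metis countable_image)
  then have "|Field (cardSuc natLeq)| \<le>o natLeq"
    using countable_card_le_natLeq by blast
  then have "cardSuc natLeq \<le>o natLeq"
    using card_of_Field_ordIso[OF Card_order_omega1] ordIso_ordLeq_trans ordIso_symmetric by blast
  then show False
    using cardSuc_greater[OF natLeq_Card_order] not_ordLess_ordLeq by blast
qed

end

lemma ex_greater_omega1: "\<exists>\<beta>. (\<alpha> :: omega1) < \<beta>"
proof -
  have "UNIV \<noteq> insert \<alpha> {..<\<alpha>}"
    using uncountable_omega1 countable_below_omega1[of \<alpha>] by (metis countable_insert)
  then obtain \<beta> where "\<beta> \<noteq> \<alpha>" "\<not> \<beta> < \<alpha>"
    by blast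
  then show ?thesis
    by (metis linorder_less_linear)
qed

instantiation omega1 :: "{zero, one}"
begin

definition zero_omega1 where
  "(0 :: omega1) = (LEAST \<alpha>. True)"

definition one_omega1 where
  "(1 :: omega1) = (LEAST \<alpha>. 0 < \<alpha>)"

instance ..

end

definition osuc :: "omega1 \<Rightarrow> omega1" where
  "osuc \<alpha> = (LEAST \<beta>. \<alpha> < \<beta>)"

lemma zero_le_omega1 [simp]: "(0 :: omega1) \<le> \<alpha>"
  unfolding zero_omega1_def by (rule Least_le) simp

lemma one_omega1_eq_osuc: "1 = osuc 0"
  by (simp add: one_omega1_def osuc_def)

lemma less_osuc [simp]: "\<alpha> < osuc \<alpha>"
  unfolding osuc_def by (rule LeastI_ex[OF ex_greater_omega1])

lemma osuc_le_iff: "osuc \<alpha> \<le> \<beta> \<longleftrightarrow> \<alpha> < \<beta>"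
proof
  show "osuc \<alpha> \<le> \<beta> \<Longrightarrow> \<alpha> < \<beta>"
    using less_osuc by (rule less_le_trans)
  show "\<alpha> < \<beta> \<Longrightarrow> osuc \<alpha> \<le> \<beta>"
    unfolding osuc_def by (rule Least_le)
qed

lemma less_osuc_iff: "\<beta> < osuc \<alpha> \<longleftrightarrow> \<beta> \<le> \<alpha>"
  using osuc_le_iff[of \<alpha> \<beta>] by (simp add: not_le[symmetric])

lemma osuc_inject [simp]: "osuc \<alpha> = osuc \<beta> \<longleftrightarrow> \<alpha> = \<beta>"
  by (metis less_osuc_iff order.antisym order_refl)

lemma osuc_neq_zero [simp]: "osuc \<alpha> \<noteq> 0"
  by (metis less_osuc not_le zero_le_omega1)

definition limit_omega1 :: "omega1 \<Rightarrow> bool" where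
  "limit_omega1 \<alpha> \<longleftrightarrow> \<alpha> \<noteq> 0 \<and> (\<nexists>\<beta>. \<alpha> = osuc \<beta>)"

(* The index n of a child is appended at the end of the sequence s. The children are an indexed
   partition: the cells for different n are disjoint. *)
definition tree_partition :: "(nat list \<Rightarrow> nat set) \<Rightarrow> bool" where
  "tree_partition A \<longleftrightarrow>
     (\<forall>s. infinite (A s)) \<and>
     A [] = UNIV \<and>
     (\<forall>s. disjoint_family (\<lambda>n. A (s @ [n])) \<and> (\<Union>n. A (s @ [n])) = A s) \<and>
     (\<forall>x y. x \<noteq> y \<longrightarrow>
        (\<exists>n s t. length s = n \<and> length t = n \<and> x \<in> A s \<and> y \<in> A t \<and> A s \<noteq> A t))"

definition Tinf :: "(nat list \<Rightarrow> nat set) \<Rightarrow> nat set \<Rightarrow> nat list set" where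
  "Tinf A X = {s. infinite (X \<inter> A s)}"

definition Fin :: "nat set set" where
  "Fin = {X. finite X}"

definition ideal_on_nat :: "nat set set \<Rightarrow> bool" where
  "ideal_on_nat I \<longleftrightarrow>
     {} \<in> I \<and>
     (\<forall>X\<in>I. \<forall>Y. Y \<subseteq> X \<longrightarrow> Y \<in> I) \<and>
     (\<forall>X\<in>I. \<forall>Y\<in>I. X \<union> Y \<in> I)"

definition proper_ideal :: "nat set set \<Rightarrow> bool" where
  "proper_ideal I \<longleftrightarrow> ideal_on_nat I \<and> UNIV \<notin> I"

definition tall :: "nat set set \<Rightarrow> bool" where
  "tall I \<longleftrightarrow> (\<forall>Y. infinite Y \<longrightarrow> (\<exists>X\<in>I. infinite X \<and> X \<subseteq> Y))"

definition Succ :: "nat list set \<Rightarrow> nat list \<Rightarrow> nat set" where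
  "Succ T s = {n. s @ [n] \<in> T}"

definition Dstep :: "nat set set \<Rightarrow> nat list set \<Rightarrow> nat list set" where
  "Dstep J T = {s \<in> T. Succ T s \<notin> J}"

function Diter :: "nat set set \<Rightarrow> omega1 \<Rightarrow> nat list set \<Rightarrow> nat list set" where
  "Diter J \<alpha> T =
     (if \<alpha> = 0 then T
      else if \<exists>\<beta>. \<alpha> = osuc \<beta> then Dstep J (Diter J (THE \<beta>. \<alpha> = osuc \<beta>) T)
      else (\<Inter>\<beta>\<in>{..<\<alpha>}. Diter J \<beta> T))"
  by auto
termination
  by (relation "inv_image {(\<beta>, \<alpha>). \<beta> < \<alpha>} (\<lambda>(J, \<alpha>, T). \<alpha>)") (auto intro: wf_inv_image wf)

declare Diter.simps [simp del]

lemma Diter_zero: "Diter J 0 T = T"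
  by (simp add: Diter.simps[of J 0])

lemma Diter_osuc: "Diter J (osuc \<alpha>) T = Dstep J (Diter J \<alpha> T)"
  by (simp add: Diter.simps[of J "osuc \<alpha>"])

lemma Diter_limit: "limit_omega1 \<alpha> \<Longrightarrow> Diter J \<alpha> T = (\<Inter>\<beta>\<in>{..<\<alpha>}. Diter J \<beta> T)"
  by (auto simp: Diter.simps[of J \<alpha>] limit_omega1_def)

definition H :: "(nat list \<Rightarrow> nat set) \<Rightarrow> nat set set \<Rightarrow> omega1 \<Rightarrow> nat set set" where
  "H A J \<alpha> = {X. [] \<notin> Diter J \<alpha> (Tinf A X)}"

end

theory Submission
  imports Defs
begin

text \<open>
  Everything rests on one description of the iterated derivative that treats zero, successors and
  limits alike (\<open>mem_Diter_iff\<close>): a node \<open>s\<close> survives \<open>\<alpha>\<close> derivations of \<open>T\<close> iff \<open>s \<in> T\<close> and, for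
  every \<open>\<beta> < \<alpha>\<close>, the set of children of \<open>s\<close> that survive \<open>\<beta>\<close> derivations is \<open>J\<close>-positive.

  The derivatives are therefore monotone in \<open>T\<close> and decreasing in \<open>\<alpha>\<close>, which gives closure under
  subsets and \<open>H A J \<alpha> \<subseteq> H A J \<beta>\<close> for \<open>\<alpha> \<le> \<beta>\<close>. For closure under unions
  (\<open>Diter_Un_subset\<close>), split the surviving children of \<open>s\<close> in \<open>T \<union> S\<close> into two decreasing families:
  if one of them drops into \<open>J\<close> at some stage, the other one is positive from that stage on, and
  hence at all earlier stages too. The ideals are proper because the full tree is its own
  derivative. Tallness is inherited from \<open>H A J 1\<close>: an infinite set either has an infinite trace on
  some cell of the first level, or it is already almost disjoint from all of them.

  Strictness needs, for each \<open>\<alpha>\<close>, a set whose tree has its root in the \<open>\<alpha>\<close>-th derivative but not in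
  the next one. The sets are built by recursion on \<open>\<alpha>\<close>, below an arbitrary node
  (\<open>ex_exact_rank\<close>): as \<open>\<alpha>\<close> is countable, there are ordinals \<open>b n < \<alpha>\<close> which are eventually above
  each \<open>\<beta> < \<alpha>\<close>; place a set of rank exactly \<open>b n\<close> into the \<open>n\<close>-th child cell. Each child
  disappears before stage \<open>\<alpha>\<close>, but at every earlier stage only finitely many have disappeared.
\<close>

section \<open>Iterated derivatives\<close>

lemma not_less_zero_omega1: "\<not> \<alpha> < (0 :: omega1)"
  by (simp add: not_less)

text \<open>
  At a limit \<open>\<alpha>\<close> the condition for \<open>\<beta> < \<alpha>\<close> is witnessed by membership in the derivative of order
  \<open>osuc \<beta> < \<alpha>\<close>.
\<close>

lemma mem_Diter_iff:
  "s \<in> Diter J \<alpha> T \<longleftrightarrow> s \<in> T \<and> (\<forall>\<beta><\<alpha>. Succ (Diter J \<beta> T) s \<notin> J)"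
proof (induction \<alpha> rule: less_induct)
  case (less \<alpha>)
  consider "\<alpha> = 0" | \<beta> where "\<alpha> = osuc \<beta>" | "limit_omega1 \<alpha>"
    by (auto simp: limit_omega1_def)
  then show ?case
  proof cases
    case 1
    then show ?thesis
      by (simp add: Diter_zero not_less_zero_omega1)
  next
    case 2
    then show ?thesis
      using less.IH[of \<beta>] by (auto simp: Diter_osuc Dstep_def less_osuc_iff order_le_less)
  next
    case 3
    then have pos: "0 < \<alpha>" and suc: "\<And>\<beta>. \<beta> < \<alpha> \<Longrightarrow> osuc \<beta> < \<alpha>"
      using osuc_le_iff[of _ \<alpha>] zero_le_omega1[of \<alpha>] unfolding limit_omega1_def
      by (metis order_le_less)+
    have "s \<in> Diter J \<alpha> T \<longleftrightarrow>
        (\<forall>\<beta><\<alpha>. s \<in> T \<and> (\<forall>\<gamma><\<beta>. Succ (Diter J \<gamma> T) s \<notin> J))"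
      using less.IH by (auto simp: Diter_limit[OF 3])
    also have "\<dots> \<longleftrightarrow> s \<in> T \<and> (\<forall>\<gamma><\<alpha>. Succ (Diter J \<gamma> T) s \<notin> J)"
      using pos suc less_osuc less_trans by blast
    finally show ?thesis .
  qed
qed

lemma Diter_antimono: "\<alpha> \<le> \<beta> \<Longrightarrow> Diter J \<beta> T \<subseteq> Diter J \<alpha> T"
  unfolding subset_iff mem_Diter_iff[of _ J \<alpha>] mem_Diter_iff[of _ J \<beta>]
  by (auto dest: less_le_trans)

lemma Succ_mono: "T \<subseteq> S \<Longrightarrow> Succ T s \<subseteq> Succ S s"
  by (auto simp: Succ_def)

lemma ideal_subset: "ideal_on_nat J \<Longrightarrow> X \<in> J \<Longrightarrow> Y \<subseteq> X \<Longrightarrow> Y \<in> J"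
  by (auto simp: ideal_on_nat_def)

lemma Diter_mono:
  assumes "ideal_on_nat J" "T \<subseteq> S"
  shows "Diter J \<alpha> T \<subseteq> Diter J \<alpha> S"
proof (induction \<alpha> rule: less_induct)
  case (less \<alpha>)
  have "Succ (Diter J \<beta> S) s \<notin> J" if "\<beta> < \<alpha>" "Succ (Diter J \<beta> T) s \<notin> J" for \<beta> s
    using that ideal_subset[OF assms(1) _ Succ_mono[OF less.IH]] by blast
  then show ?case
    using assms(2) unfolding subset_iff mem_Diter_iff[of _ J \<alpha>] by blast
qed

text \<open>
  The tree property of \<open>T\<close> and \<open>S\<close> is what places \<open>s\<close> itself into the right one of the two trees
  once it is known which of them contributes positively many children.
\<close>

lemma Diter_Un_subset:
  assumes J: "ideal_on_nat J"
    and T: "\<And>s n. s @ [n] \<in> T \<Longrightarrow> s \<in> T"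
    and S: "\<And>s n. s @ [n] \<in> S \<Longrightarrow> s \<in> S"
  shows "Diter J \<alpha> (T \<union> S) \<subseteq> Diter J \<alpha> T \<union> Diter J \<alpha> S"
proof (induction \<alpha> rule: less_induct)
  case (less \<alpha>)
  show ?case
  proof (cases "\<alpha> = 0")
    case True
    then show ?thesis
      by (simp add: Diter_zero)
  next
    case False
    then have pos: "0 < \<alpha>"
      by (simp add: order_less_le)
    have positive: "s \<in> Diter J \<alpha> U"
      if U: "\<And>s n. s @ [n] \<in> U \<Longrightarrow> s \<in> U"
        and large: "\<And>\<beta>. \<beta> < \<alpha> \<Longrightarrow> Succ (Diter J \<beta> U) s \<notin> J" for U s
    proof -
      have "Succ U s \<noteq> {}"
        using large[OF pos] J by (auto simp: Diter_zero ideal_on_nat_def)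
      then have "s \<in> U"
        using U by (auto simp: Succ_def)
      then show ?thesis
        using large by (simp add: mem_Diter_iff[of s J \<alpha>])
    qed
    show ?thesis
    proof (intro subsetI)
      fix s
      assume s: "s \<in> Diter J \<alpha> (T \<union> S)"
      have split: "Succ (Diter J \<beta> T) s \<notin> J \<or> Succ (Diter J \<beta> S) s \<notin> J" if "\<beta> < \<alpha>" for \<beta>
      proof -
        have "Succ (Diter J \<beta> (T \<union> S)) s \<subseteq> Succ (Diter J \<beta> T) s \<union> Succ (Diter J \<beta> S) s"
          using less.IH[OF that] by (auto simp: Succ_def)
        moreover have "Succ (Diter J \<beta> (T \<union> S)) s \<notin> J"
          using s that by (simp add: mem_Diter_iff[of s J \<alpha>])
        ultimately show ?thesis
          using J unfolding ideal_on_nat_def by blast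
      qed
      show "s \<in> Diter J \<alpha> T \<union> Diter J \<alpha> S"
      proof (cases "\<forall>\<beta><\<alpha>. Succ (Diter J \<beta> T) s \<notin> J")
        case True
        then show ?thesis
          using positive[of T s] T by blast
      next
        case False
        then obtain \<gamma> where \<gamma>: "\<gamma> < \<alpha>" "Succ (Diter J \<gamma> T) s \<in> J"
          by blast
        have "Succ (Diter J \<beta> S) s \<notin> J" if "\<beta> < \<alpha>" for \<beta>
        proof
          assume small: "Succ (Diter J \<beta> S) s \<in> J"
          \<comment> \<open>Both families have dropped into the ideal at the later one of the two stages.\<close>
          have "Succ (Diter J (max \<beta> \<gamma>) S) s \<in> J" "Succ (Diter J (max \<beta> \<gamma>) T) s \<in> J"
            using ideal_subset[OF J small Succ_mono[OF Diter_antimono]]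
              ideal_subset[OF J \<gamma>(2) Succ_mono[OF Diter_antimono]] by simp_all
          then show False
            using split[of "max \<beta> \<gamma>"] \<gamma>(1) that by auto
        qed
        then show ?thesis
          using positive[of S s] S by blast
      qed
    qed
  qed
qed

text \<open>Whether a node survives depends only on the part of the tree above it.\<close>

lemma Diter_local:
  assumes "\<And>t. s @ t \<in> T \<longleftrightarrow> s @ t \<in> S"
  shows "s \<in> Diter J \<alpha> T \<longleftrightarrow> s \<in> Diter J \<alpha> S"
  using assms
proof (induction \<alpha> arbitrary: s rule: less_induct)
  case (less \<alpha>)
  have "Succ (Diter J \<beta> T) s = Succ (Diter J \<beta> S) s" if "\<beta> < \<alpha>" for \<beta>
  proof -
    have "s @ [n] \<in> Diter J \<beta> T \<longleftrightarrow> s @ [n] \<in> Diter J \<beta> S" for n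
      by (rule less.IH[OF that]) (simp add: less.prems)
    then show ?thesis
      by (simp add: Succ_def)
  qed
  moreover have "s \<in> T \<longleftrightarrow> s \<in> S"
    using less.prems[of "[]"] by simp
  ultimately show ?case
    unfolding mem_Diter_iff[of s J \<alpha>] by metis
qed

lemma Diter_UNIV: "UNIV \<notin> J \<Longrightarrow> Diter J \<alpha> UNIV = UNIV"
proof (induction \<alpha> rule: less_induct)
  case (less \<alpha>)
  then have "Succ (Diter J \<beta> UNIV) s \<notin> J" if "\<beta> < \<alpha>" for \<beta> s
    using that by (simp add: Succ_def)
  then show ?case
    by (simp add: set_eq_iff mem_Diter_iff[of _ J \<alpha>])
qed

section \<open>Cells of a tree partition\<close>

lemma cell_infinite: "tree_partition A \<Longrightarrow> infinite (A s)"
  by (simp add: tree_partition_def)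

lemma cell_root: "tree_partition A \<Longrightarrow> A [] = UNIV"
  by (simp add: tree_partition_def)

lemma cell_UN_children: "tree_partition A \<Longrightarrow> (\<Union>n. A (s @ [n])) = A s"
  by (simp add: tree_partition_def)

lemma cell_children_disjoint:
  "tree_partition A \<Longrightarrow> m \<noteq> n \<Longrightarrow> A (s @ [m]) \<inter> A (s @ [n]) = {}"
  by (auto simp: tree_partition_def disjoint_family_on_def)

lemma cell_append_subset:
  assumes "tree_partition A"
  shows "A (s @ t) \<subseteq> A s"
proof (induction t rule: rev_induct)
  case (snoc n t)
  then show ?case
    using cell_UN_children[OF assms, of "s @ t"] by auto
qed simp

lemma Tinf_Un: "Tinf A (X \<union> Y) = Tinf A X \<union> Tinf A Y"
  by (auto simp: Tinf_def Int_Un_distrib2)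

lemma Tinf_mono: "X \<subseteq> Y \<Longrightarrow> Tinf A X \<subseteq> Tinf A Y"
  by (metis Tinf_Un le_iff_sup)

lemma Tinf_parent:
  assumes "tree_partition A" "s @ [n] \<in> Tinf A X"
  shows "s \<in> Tinf A X"
proof -
  have "X \<inter> A (s @ [n]) \<subseteq> X \<inter> A s"
    using cell_append_subset[OF assms(1), of s "[n]"] by blast
  then show ?thesis
    using assms(2) finite_subset unfolding Tinf_def by blast
qed

lemma mem_Diter_Tinf_cong:
  assumes A: "tree_partition A" and eq: "X \<inter> A s = Y \<inter> A s"
  shows "s \<in> Diter J \<alpha> (Tinf A X) \<longleftrightarrow> s \<in> Diter J \<alpha> (Tinf A Y)"
proof (rule Diter_local)
  fix t
  have "X \<inter> A (s @ t) = Y \<inter> A (s @ t)"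
    using cell_append_subset[OF A, of s t] eq by blast
  then show "s @ t \<in> Tinf A X \<longleftrightarrow> s @ t \<in> Tinf A Y"
    by (simp add: Tinf_def)
qed

section \<open>Properness, closure under unions, tallness\<close>

lemma H_mono: "\<alpha> \<le> \<beta> \<Longrightarrow> H A J \<alpha> \<subseteq> H A J \<beta>"
  using subsetD[OF Diter_antimono[of \<alpha> \<beta> J]] by (auto simp: H_def)

lemma proper_ideal_H:
  assumes A: "tree_partition A" and J: "proper_ideal J"
  shows "proper_ideal (H A J \<alpha>)"
proof -
  have ideal: "ideal_on_nat J" and "UNIV \<notin> J"
    using J by (auto simp: proper_ideal_def)
  have "Tinf A UNIV = UNIV"
    using cell_infinite[OF A] by (simp add: Tinf_def)
  then have "UNIV \<notin> H A J \<alpha>"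
    using Diter_UNIV[OF \<open>UNIV \<notin> J\<close>] by (simp add: H_def)
  moreover have "{} \<in> H A J \<alpha>"
    by (simp add: H_def mem_Diter_iff[of _ J \<alpha>] Tinf_def)
  moreover have "Y \<in> H A J \<alpha>" if "X \<in> H A J \<alpha>" "Y \<subseteq> X" for X Y
    using that(1) subsetD[OF Diter_mono[OF ideal Tinf_mono[OF that(2)]]]
    by (auto simp: H_def)
  moreover have "X \<union> Y \<in> H A J \<alpha>" if "X \<in> H A J \<alpha>" "Y \<in> H A J \<alpha>" for X Y
    using that subsetD[OF Diter_Un_subset[OF ideal, of "Tinf A X" "Tinf A Y"]]
      Tinf_parent[OF A] unfolding H_def Tinf_Un mem_Collect_eq by (metis UnE)
  ultimately show ?thesis
    by (simp add: proper_ideal_def ideal_on_nat_def)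
qed

lemma tall_mono: "tall I \<Longrightarrow> I \<subseteq> K \<Longrightarrow> tall K"
  unfolding tall_def by blast

lemma H_1_iff:
  "X \<in> H A J 1 \<longleftrightarrow> [] \<notin> Tinf A X \<or> Succ (Tinf A X) [] \<in> J"
  by (auto simp: H_def one_omega1_eq_osuc Diter_osuc Diter_zero Dstep_def)

lemma tall_H_1:
  assumes A: "tree_partition A" and fin: "Fin \<subseteq> J"
  shows "tall (H A J 1)"
  unfolding tall_def
proof (intro allI impI)
  fix Y :: "nat set"
  assume Y: "infinite Y"
  show "\<exists>X\<in>H A J 1. infinite X \<and> X \<subseteq> Y"
  proof (cases "\<exists>n. infinite (Y \<inter> A [n])")
    case True
    then obtain n where n: "infinite (Y \<inter> A [n])"
      by blast
    have "Y \<inter> A [n] \<inter> A [m] = {}" if "m \<noteq> n" for m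
      using cell_children_disjoint[OF A that, of "[]"] by auto
    then have "Succ (Tinf A (Y \<inter> A [n])) [] \<subseteq> {n}"
      by (force simp: Succ_def Tinf_def)
    then have "Succ (Tinf A (Y \<inter> A [n])) [] \<in> J"
      using fin finite_subset by (auto simp: Fin_def)
    then show ?thesis
      using n by (intro bexI[of _ "Y \<inter> A [n]"]) (auto simp: H_1_iff)
  next
    case False
    then have "Succ (Tinf A Y) [] = {}"
      by (auto simp: Succ_def Tinf_def)
    then have "Y \<in> H A J 1"
      using fin by (auto simp: H_1_iff Fin_def)
    then show ?thesis
      using Y by blast
  qed
qed

section \<open>Sets of prescribed rank\<close>

text \<open>
  Taking the maximum of the first \<open>n\<close> terms of an enumeration of the ordinals below \<open>\<alpha>\<close> covers
  successors, where the sequence is eventually the predecessor, together with limits.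
\<close>

lemma ex_eventually_dominating_omega1:
  fixes \<alpha> :: omega1
  assumes "0 < \<alpha>"
  shows "\<exists>b :: nat \<Rightarrow> omega1. (\<forall>n. b n < \<alpha>) \<and> (\<forall>\<beta><\<alpha>. finite {n. b n < \<beta>})"
proof -
  have ne: "{..<\<alpha>} \<noteq> {}"
    using assms by auto
  define e where "e = from_nat_into {..<\<alpha>}"
  have range: "range e = {..<\<alpha>}"
    unfolding e_def using range_from_nat_into[OF ne countable_below_omega1] .
  define b where "b n = Max (e ` {..n})" for n
  have "b n < \<alpha>" for n
    using range by (auto simp: b_def)
  moreover have "finite {n. b n < \<beta>}" if "\<beta> < \<alpha>" for \<beta>
  proof -
    have "\<beta> \<in> range e"
      using that unfolding range by simp
    then obtain k where k: "\<beta> = e k"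
      by blast
    have "\<beta> \<le> b n" if "k \<le> n" for n
      unfolding b_def k using that by (intro Max_ge) auto
    then have "{n. b n < \<beta>} \<subseteq> {..<k}"
      unfolding subset_iff mem_Collect_eq lessThan_iff by (metis leD not_le_imp_less)
    then show ?thesis
      by (rule finite_subset) simp
  qed
  ultimately show ?thesis
    by blast
qed

text \<open>Rank zero: a selector of the child cells is infinite but meets each of them only once.\<close>

lemma ex_exact_rank_zero:
  assumes A: "tree_partition A" and "{} \<in> J"
  shows "\<exists>X \<subseteq> A s. s \<in> Tinf A X \<and> Succ (Tinf A X) s \<in> J"
proof -
  have "\<exists>x. x \<in> A (s @ [n])" for n
    using cell_infinite[OF A, of "s @ [n]"] by (metis ex_in_conv finite.emptyI)
  then obtain f where f: "\<And>n. f n \<in> A (s @ [n])"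
    by metis
  have eq: "m = n" if "f m \<in> A (s @ [n])" for m n
    using that f[of m] cell_children_disjoint[OF A, of m n s] by blast
  then have "inj f"
    using f by (metis injI)
  then have "infinite (range f)"
    by (rule range_inj_infinite)
  moreover have sub: "range f \<subseteq> A s"
    using f cell_UN_children[OF A, of s] by blast
  ultimately have "s \<in> Tinf A (range f)"
    by (simp add: Tinf_def Int_absorb2)
  moreover have "finite (range f \<inter> A (s @ [n]))" for n
    by (rule finite_subset[of _ "{f n}"]) (use eq in auto)
  then have "Succ (Tinf A (range f)) s = {}"
    by (simp add: Succ_def Tinf_def)
  ultimately show ?thesis
    using sub \<open>{} \<in> J\<close> by metis
qed

lemma ex_exact_rank:
  assumes A: "tree_partition A" and J: "proper_ideal J" and fin: "Fin \<subseteq> J"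
  shows "\<exists>X \<subseteq> A s. s \<in> Diter J \<alpha> (Tinf A X) \<and> s \<notin> Diter J (osuc \<alpha>) (Tinf A X)"
proof (induction \<alpha> arbitrary: s rule: less_induct)
  case (less \<alpha>)
  have ideal: "ideal_on_nat J" and "UNIV \<notin> J"
    using J by (auto simp: proper_ideal_def)
  have empty: "{} \<in> J"
    using ideal by (simp add: ideal_on_nat_def)
  show ?case
  proof (cases "\<alpha> = 0")
    case True
    then show ?thesis
      using ex_exact_rank_zero[OF A empty, of s] by (auto simp: Diter_osuc Diter_zero Dstep_def)
  next
    case False
    then have "0 < \<alpha>"
      by (simp add: order_less_le)
    then obtain b :: "nat \<Rightarrow> omega1"
      where b: "\<And>n. b n < \<alpha>" "\<And>\<beta>. \<beta> < \<alpha> \<Longrightarrow> finite {n. b n < \<beta>}"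
      using ex_eventually_dominating_omega1 by blast
    have "\<forall>n. \<exists>X \<subseteq> A (s @ [n]). s @ [n] \<in> Diter J (b n) (Tinf A X) \<and>
        s @ [n] \<notin> Diter J (osuc (b n)) (Tinf A X)"
      using less.IH[OF b(1)] by blast
    from choice[OF this] obtain X where X: "\<And>n. X n \<subseteq> A (s @ [n])"
      "\<And>n. s @ [n] \<in> Diter J (b n) (Tinf A (X n))"
      "\<And>n. s @ [n] \<notin> Diter J (osuc (b n)) (Tinf A (X n))"
      by blast
    define Y where "Y = (\<Union>n. X n)"
    have "m = n" if "x \<in> X m" "x \<in> A (s @ [n])" for x m n
      using X(1)[of m] that cell_children_disjoint[OF A, of m n s] by blast
    then have "Y \<inter> A (s @ [n]) = X n \<inter> A (s @ [n])" for n
      unfolding Y_def by blast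
    note local = mem_Diter_Tinf_cong[OF A this]
    have in_b: "s @ [n] \<in> Diter J (b n) (Tinf A Y)" for n
      using X(2) local by simp
    have "s @ [n] \<notin> Diter J \<alpha> (Tinf A Y)" for n
      using X(3)[of n] local subsetD[OF Diter_antimono[of "osuc (b n)" \<alpha>]] b(1)[of n]
      by (auto simp: osuc_le_iff)
    then have "Succ (Diter J \<alpha> (Tinf A Y)) s = {}"
      by (simp add: Succ_def)
    then have out: "s \<notin> Diter J (osuc \<alpha>) (Tinf A Y)"
      using empty by (simp add: Diter_osuc Dstep_def)
    have "Succ (Diter J \<beta> (Tinf A Y)) s \<notin> J" if "\<beta> < \<alpha>" for \<beta>
    proof
      assume small: "Succ (Diter J \<beta> (Tinf A Y)) s \<in> J"
      have "{n. b n < \<beta>} \<in> J"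
        using fin b(2)[OF that] by (auto simp: Fin_def)
      moreover have "UNIV = Succ (Diter J \<beta> (Tinf A Y)) s \<union> {n. b n < \<beta>}"
        using in_b subsetD[OF Diter_antimono] by (auto simp: Succ_def not_less)
      ultimately show False
        using small ideal \<open>UNIV \<notin> J\<close> unfolding ideal_on_nat_def by metis
    qed
    moreover have "s \<in> Tinf A Y"
      using in_b[of 0] Tinf_parent[OF A, of s 0] unfolding mem_Diter_iff[of _ J "b 0"] by blast
    ultimately have "s \<in> Diter J \<alpha> (Tinf A Y)"
      by (simp add: mem_Diter_iff[of s J \<alpha>])
    moreover have "Y \<subseteq> A s"
      using X(1) cell_UN_children[OF A, of s] unfolding Y_def by blast
    ultimately show ?thesis
      using out by blast
  qed
qed

theorem theorem3p4:
  fixes A :: "nat list \<Rightarrow> nat set" and J :: "nat set set"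
  assumes "tree_partition A"
    and "proper_ideal J" and "Fin \<subseteq> J"
  shows "\<forall>\<alpha> :: omega1.
           proper_ideal (H A J \<alpha>) \<and>
           (\<alpha> \<ge> 1 \<longrightarrow> tall (H A J \<alpha>)) \<and>
           H A J \<alpha> \<subset> H A J (osuc \<alpha>)"
proof (intro allI conjI impI)
  fix \<alpha> :: omega1
  show "proper_ideal (H A J \<alpha>)"
    using assms(1,2) by (rule proper_ideal_H)
  show "tall (H A J \<alpha>)" if "1 \<le> \<alpha>"
    using tall_H_1[OF assms(1,3)] H_mono[OF that] by (rule tall_mono)
  show "H A J \<alpha> \<subset> H A J (osuc \<alpha>)"
    using H_mono[of \<alpha> "osuc \<alpha>" A J] ex_exact_rank[OF assms, of "[]" \<alpha>]
    by (auto simp: H_def order_less_imp_le)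
qed

end
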